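(* Let $S=F_D\cup\widehat{F}\cup\widehat{\Lambda}_{I,p,d}\cup\Sigma_{p,d,P}$ be a two-sided subsemigroup (of the second form) of the bicyclic monoid $\mathcal{B}$, with $S\ne\mathcal{B}$. Then $S$ is a left I-order in $\mathcal{B}$ if and only if $d=1$ and $I=\{0,\dots,p-1\}$.
   Context: The bicyclic monoid $\mathcal{B}$ is the monoid generated by $a,b$ subject to $ba=1$; its elements are uniquely of the form $a^ib^j$ with $i,j\ge 0$, with $a^kb^l\,a^mb^n=a^{k-l+t}b^{n-m+t}$ where $t=\max\{l,m\}$. It is an inverse monoid with $(a^ib^j)^{-1}=a^jb^i$. A subsemigroup $S$ of an inverse semigroup $Q$ is a left I-order in $Q$ if every element of $Q$ can be written as $s^{-1}t$ with $s,t\in S$. Notation: $\mathbb{N}$ is the set of positive integers, $\mathbb{N}^0=\mathbb{N}\cup\{0\}$; $D=\{a^ib^i: i\ge 0\}$; $L^q=\{a^ib^j: 0\le j\le q,\ i\ge 0\}$; $T_{q,p}=\{a^ib^j : q\le i\le j<p\}$; $\Lambda_{I,p,d}=\{a^ib^j : i\in I,\ d\mid j-i,\ j\ge p\}$; $\Sigma_{p,d,P}=\{a^{p+r+ud}b^{p+r+vd} : r\in P,\ u,v\ge 0\}$; for $X\subseteq\mathcal{B}$, $\widehat{X}=\{a^jb^i : a^ib^j\in X\}$. A two-sided subsemigroup of the second form is a subsemigroup $S=F_D\cup\widehat{F}\cup\widehat{\Lambda}_{I,p,d}\cup\Sigma_{p,d,P}$ of $\mathcal{B}$, where $q,p\in\mathbb{N}^0$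 with $q\le p$, $d\in\mathbb{N}$, $I\subseteq\{q,\dots,p-1\}$ with $q\in I$, $P\subseteq\{0,\dots,d-1\}$ with $0\in P$, $F_D\subseteq D\cap L^q$ and $F\subseteq T_{q,p}$. *)

theory Defs
  imports Main
begin

class inverse_semigroup = semigroup_mult +
  assumes ex1_semigroup_inverse: "\<exists>!y. x * y * x = x \<and> y * x * y = y"

definition sinv :: "'a::inverse_semigroup \<Rightarrow> 'a" where
  "sinv x = (THE y. x * y * x = x \<and> y * x * y = y)"

definition subsemigroup :: "'a::semigroup_mult set \<Rightarrow> bool" where
  "subsemigroup S \<longleftrightarrow> S \<noteq> {} \<and> (\<forall>x\<in>S. \<forall>y\<in>S. x * y \<in> S)"

definition left_I_order :: "'a::inverse_semigroup set \<Rightarrow> bool" where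
  "left_I_order S \<longleftrightarrow> subsemigroup S \<and> (\<forall>x. \<exists>s\<in>S. \<exists>t\<in>S. x = sinv s * t)"

text \<open>The bicyclic monoid, through its normal forms: \<open>AB i j\<close> stands for \<open>a\<^sup>i b\<^sup>j\<close>.
  Lemmas \<open>AB_normal_form\<close>, \<open>bicyclic_ba\<close> and \<open>bicyclic_universal\<close> below identify it with the
  monoid presented by generators \<open>a\<close>, \<open>b\<close> and the relation \<open>ba = 1\<close>.\<close>

datatype bicyclic = AB nat nat

instantiation bicyclic :: monoid_mult
begin

definition one_bicyclic :: bicyclic where
  "1 = AB 0 0"

text \<open>The additions come first so that the truncated subtractions on \<open>nat\<close> are exact:
  \<open>l \<le> max l m\<close> and \<open>m \<le> max l m\<close>.\<close>

fun times_bicyclic :: "bicyclic \<Rightarrow> bicyclic \<Rightarrow> bicyclic" where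
  "AB k l * AB m n = AB (k + max l m - l) (n + max l m - m)"

instance
proof
  fix x y z :: bicyclic
  show "x * y * z = x * (y * z)"
    by (cases x; cases y; cases z) (auto simp: max_def)
  show "1 * x = x" by (cases x) (simp add: one_bicyclic_def)
  show "x * 1 = x" by (cases x) (simp add: one_bicyclic_def)
qed

end

lemma bicyclic_inverse_iff:
  "AB i j * y * AB i j = AB i j \<and> y * AB i j * y = y \<longleftrightarrow> y = AB j i"
  by (cases y) (auto simp: max_def split: if_splits)

instance bicyclic :: inverse_semigroup
proof
  fix x :: bicyclic
  show "\<exists>!y. x * y * x = x \<and> y * x * y = y"
    by (cases x) (simp only: bicyclic_inverse_iff, blast)
qed

lemma sinv_AB: "sinv (AB i j) = AB j i"
  by (simp only: sinv_def bicyclic_inverse_iff the_eq_trivial)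

lemma bicyclic_ba: "AB 0 1 * AB 1 0 = 1"
  by (simp add: one_bicyclic_def)

lemma AB_normal_form: "AB i j = AB 1 0 ^ i * AB 0 1 ^ j"
proof -
  have "AB 1 0 ^ i = AB i 0" by (induction i) (auto simp: one_bicyclic_def)
  moreover have "AB 0 1 ^ j = AB 0 j" by (induction j) (auto simp: one_bicyclic_def)
  ultimately show ?thesis by simp
qed

lemma bicyclic_universal:
  fixes x y :: "'m::monoid_mult"
  assumes "y * x = 1"
  shows "\<exists>!f. f 1 = 1 \<and> (\<forall>u v. f (u * v) = f u * f v) \<and> f (AB 1 0) = x \<and> f (AB 0 1) = y"
proof -
  have yx: "y ^ n * x ^ n = 1" for n
  proof (induction n)
    case (Suc n)
    have "y ^ Suc n * x ^ Suc n = y ^ n * (y * x) * x ^ n"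
      by (simp only: power_Suc2[of y] power_Suc[of x] mult.assoc)
    then show ?case using Suc assms by simp
  qed simp
  have ge: "y ^ (c + n) * x ^ n = y ^ c" for c n
    by (simp add: power_add mult.assoc yx)
  have le: "y ^ n * x ^ (n + c) = x ^ c" for c n
    by (simp add: power_add mult.assoc[symmetric] yx)
  define f where "f u = (case u of AB i j \<Rightarrow> x ^ i * y ^ j)" for u
  have mul: "f (AB k l * AB m n) = f (AB k l) * f (AB m n)" for k l m n
  proof (cases "m \<le> l")
    case True
    then obtain c where c: "l = c + m" by (metis le_iff_add add.commute)
    have "x ^ k * y ^ l * (x ^ m * y ^ n) = x ^ k * (y ^ (c + m) * x ^ m) * y ^ n"
      by (simp add: c mult.assoc)
    also have "\<dots> = x ^ k * y ^ (c + n)" by (simp only: ge) (simp add: power_add mult.assoc)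
    finally show ?thesis by (simp add: f_def c max_def add.commute)
  next
    case False
    then obtain c where c: "m = l + c" by (metis le_iff_add nat_le_linear)
    have "x ^ k * y ^ l * (x ^ m * y ^ n) = x ^ k * (y ^ l * x ^ (l + c)) * y ^ n"
      by (simp add: c mult.assoc)
    also have "\<dots> = x ^ (k + c) * y ^ n" by (simp only: le) (simp add: power_add mult.assoc)
    finally show ?thesis by (simp add: f_def c max_def)
  qed
  have hom: "f 1 = 1 \<and> (\<forall>u v. f (u * v) = f u * f v) \<and> f (AB 1 0) = x \<and> f (AB 0 1) = y"
  proof (intro conjI allI)
    show "f (u * v) = f u * f v" for u v by (cases u; cases v) (simp only: mul)
  qed (simp_all add: f_def one_bicyclic_def)
  show ?thesis
  proof (rule ex1I[of _ f])
    fix g assume g: "g 1 = 1 \<and> (\<forall>u v. g (u * v) = g u * g v) \<and> g (AB 1 0) = x \<and> g (AB 0 1) = y"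
    have pow: "g (u ^ n) = g u ^ n" for u n
      by (induction n) (use g in auto)
    have "g (AB i j) = x ^ i * y ^ j" for i j
      unfolding AB_normal_form[of i j] using g pow by metis
    then show "g = f" by (intro ext) (simp add: f_def split: bicyclic.split)
  qed (fact hom)
qed

definition diag :: "bicyclic set" where
  "diag = {AB i i | i. True}"

definition Lset :: "nat \<Rightarrow> bicyclic set" where
  "Lset q = {AB i j | i j. j \<le> q}"

definition Tset :: "nat \<Rightarrow> nat \<Rightarrow> bicyclic set" where
  "Tset q p = {AB i j | i j. q \<le> i \<and> i \<le> j \<and> j < p}"

definition Lambda :: "nat set \<Rightarrow> nat \<Rightarrow> nat \<Rightarrow> bicyclic set" where
  "Lambda I p d = {AB i j | i j. i \<in> I \<and> int d dvd int j - int i \<and> p \<le> j}"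

definition Sigma_set :: "nat \<Rightarrow> nat \<Rightarrow> nat set \<Rightarrow> bicyclic set" where
  "Sigma_set p d P = {AB (p + r + u * d) (p + r + v * d) | r u v. r \<in> P}"

definition hat :: "bicyclic set \<Rightarrow> bicyclic set" where
  "hat X = {AB j i | i j. AB i j \<in> X}"

definition two_sided_second_form ::
  "bicyclic set \<Rightarrow> nat \<Rightarrow> nat \<Rightarrow> nat \<Rightarrow> nat set \<Rightarrow> nat set \<Rightarrow> bicyclic set \<Rightarrow> bicyclic set \<Rightarrow> bool" where
  "two_sided_second_form S q p d I P FD F \<longleftrightarrow>
     subsemigroup S \<and>
     q \<le> p \<and> d > 0 \<and>
     I \<subseteq> {q..<p} \<and> q \<in> I \<and>
     P \<subseteq> {0..<d} \<and> 0 \<in> P \<and>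
     FD \<subseteq> diag \<inter> Lset q \<and> F \<subseteq> Tset q p \<and>
     S = FD \<union> hat F \<union> hat (Lambda I p d) \<union> Sigma_set p d P"

end

theory Submission
  imports Defs
begin

text \<open>Every \<open>a\<^sup>xb\<^sup>y \<in> S\<close> satisfies \<open>d dvd x - y\<close>: on \<open>F\<close> this follows by multiplying with the
  idempotent \<open>a\<^sup>pb\<^sup>p\<close>, which lands in \<open>\<Sigma>\<close>. Hence writing \<open>b\<close> as a quotient forces \<open>d = 1\<close>.
  For \<open>j < p\<close>, write \<open>a\<^sup>pb\<^sup>j = s\<^sup>-\<^sup>1t\<close>; either \<open>t\<close> itself or \<open>a\<^sup>kb\<^sup>kt\<close> for a suitable \<open>k \<ge> p\<close> is
  an element \<open>a\<^sup>mb\<^sup>j\<close> of \<open>S\<close> with \<open>m \<ge> p\<close>, which must lie in \<open>\<Lambda>\<close> (reflected), so \<open>j \<in> I\<close>.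
  Conversely, \<open>a\<^sup>ib\<^sup>j = (a\<^sup>kb\<^sup>i)\<^sup>-\<^sup>1 a\<^sup>kb\<^sup>j\<close> with \<open>k = p\<close>.\<close>

lemma AB_in_hat_Lambda_iff:
  "AB x y \<in> hat (Lambda I p d) \<longleftrightarrow> y \<in> I \<and> int d dvd int x - int y \<and> p \<le> x"
  by (auto simp: hat_def Lambda_def)

lemma AB_in_Sigma_set_iff:
  "AB x y \<in> Sigma_set p d P \<longleftrightarrow> (\<exists>r\<in>P. \<exists>u v. x = p + r + u * d \<and> y = p + r + v * d)"
  by (auto simp: Sigma_set_def)

lemma mem_FD:
  assumes "FD \<subseteq> diag \<inter> Lset q" "AB x y \<in> FD"
  shows "x = y" "y \<le> q"
  using assms by (auto simp: diag_def Lset_def)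

lemma mem_hat_F:
  assumes "F \<subseteq> Tset q p" "AB x y \<in> hat F"
  shows "q \<le> y" "y \<le> x" "x < p"
  using assms by (auto simp: hat_def Tset_def)

locale second_form =
  fixes S FD F :: "bicyclic set" and q p d :: nat and I P :: "nat set"
  assumes form: "two_sided_second_form S q p d I P FD F"
begin

lemma I_less: "i \<in> I \<Longrightarrow> i < p" and q_less: "q < p"
  and zero_in_P: "0 \<in> P"
  and FD_sub: "FD \<subseteq> diag \<inter> Lset q" and F_sub: "F \<subseteq> Tset q p"
  using form by (auto simp: two_sided_second_form_def)

lemma S_eq: "S = FD \<union> hat F \<union> hat (Lambda I p d) \<union> Sigma_set p d P"
  using form by (simp add: two_sided_second_form_def)

lemma subsemigroup_S: "subsemigroup S"
  using form unfolding two_sided_second_form_def by blast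

lemma mult_closed: "s \<in> S \<Longrightarrow> t \<in> S \<Longrightarrow> s * t \<in> S"
  using subsemigroup_S by (simp add: subsemigroup_def)

text \<open>Only numerical bounds survive for \<open>FD\<close> and \<open>F\<close>, which are
  arbitrary subsets of \<open>diag \<inter> Lset q\<close> and \<open>Tset q p\<close>.\<close>

lemma S_cases:
  assumes "AB x y \<in> S"
  obtains (FD) "x = y" "y \<le> q" | (F) "q \<le> y" "y \<le> x" "x < p"
    | (Lambda) "y \<in> I" "int d dvd int x - int y" "p \<le> x"
    | (Sigma) r u v where "r \<in> P" "x = p + r + u * d" "y = p + r + v * d"
proof -
  from assms consider "AB x y \<in> FD" | "AB x y \<in> hat F" | "AB x y \<in> hat (Lambda I p d)"
    | "AB x y \<in> Sigma_set p d P"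
    unfolding S_eq by blast
  then show thesis
  proof cases
    case 1
    then show ?thesis using mem_FD[OF FD_sub] that(1) by blast
  next
    case 2
    then show ?thesis using mem_hat_F[OF F_sub] that(2) by blast
  next
    case 3
    then show ?thesis using that(3) by (simp add: AB_in_hat_Lambda_iff)
  next
    case 4
    then show ?thesis using that(4) by (auto simp: AB_in_Sigma_set_iff)
  qed
qed

lemma Sigma_zero_mem: "AB (p + u * d) (p + v * d) \<in> S"
  unfolding S_eq Un_iff AB_in_Sigma_set_iff
  using zero_in_P by (intro disjI2 bexI[of _ 0] exI[of _ u] exI[of _ v]) simp_all

text \<open>In the other three parts the second exponent is below \<open>p\<close>; in
  \<open>Sigma_set\<close>, \<open>p = p + r + v * d\<close> forces \<open>r = 0\<close>.\<close>

lemma second_eq_p: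
  assumes "AB x p \<in> S"
  obtains u where "x = p + u * d"
  using assms
proof (cases rule: S_cases)
  case (Sigma r u v)
  then show ?thesis using that by auto
qed (use q_less I_less in auto)

lemma diff_dvd:
  assumes "AB x y \<in> S"
  shows "int d dvd int x - int y"
  using assms
proof (cases rule: S_cases)
  case F
  have "AB x y * AB p p \<in> S"
    using mult_closed[OF assms Sigma_zero_mem[of 0 0]] by simp
  then have "AB (x + p - y) p \<in> S" using F by (simp add: max_def)
  then obtain u where "x + p - y = p + u * d" by (rule second_eq_p)
  then have "x = y + u * d" using F by linarith
  then show ?thesis by simp
next
  case (Sigma r u v)
  then have "int x - int y = int d * (int u - int v)"
    by (simp add: algebra_simps)
  then show ?thesis by simp
qed auto

lemma second_less_p_le_first:
  assumes "AB x y \<in> S" "y < p"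
  shows "y \<le> x"
  using assms by (cases rule: S_cases) auto

lemma second_less_p_in_I:
  assumes "AB x y \<in> S" "y < p" "p \<le> x"
  shows "y \<in> I"
  using assms by (cases rule: S_cases) auto

lemma left_I_order_imp_d:
  assumes "left_I_order S"
  shows "d = 1"
proof -
  obtain s t where st: "s \<in> S" "t \<in> S" "AB 0 1 = sinv s * t"
    using assms unfolding left_I_order_def by blast
  obtain k l m n where eq: "s = AB k l" "t = AB m n" by (metis bicyclic.exhaust)
  \<comment> \<open>Sending \<open>AB i j\<close> to \<open>i - j\<close> is a homomorphism to the
    integers with value -1 at \<open>AB 0 1\<close>, so \<open>d\<close> divides 1.\<close>
  have "int d dvd (int k - int l) - (int m - int n)"
    using st(1,2) unfolding eq by (intro dvd_diff diff_dvd)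
  moreover have "0 = l + max k m - k" "1 = n + max k m - m"
    using st(3) by (simp_all add: eq sinv_AB)
  then have "(int k - int l) - (int m - int n) = 1" by linarith
  ultimately show ?thesis by simp
qed

lemma left_I_order_imp_mem_I:
  assumes "left_I_order S" "j < p"
  shows "j \<in> I"
proof -
  obtain s t where st: "s \<in> S" "t \<in> S" "AB p j = sinv s * t"
    using assms unfolding left_I_order_def by blast
  obtain k l m n where eq: "s = AB k l" "t = AB m n" by (metis bicyclic.exhaust)
  have klmn: "p = l + max k m - k" "j = n + max k m - m"
    using st(3) by (simp_all add: eq sinv_AB)
  show ?thesis
  proof (cases "m \<le> k")
    case True
    then have "l = p" "j = n + k - m" using klmn by auto
    \<comment> \<open>Now \<open>s = AB k p\<close>, so \<open>AB k k\<close> lies in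
      \<open>S\<close>; as \<open>m \<le> k\<close>, it raises the first exponent of
      \<open>t\<close> to \<open>k \<ge> p\<close> and the second to \<open>j\<close>.\<close>
    with st(1) eq obtain u where u: "k = p + u * d" using second_eq_p by blast
    have "AB k k * AB m n \<in> S"
      using mult_closed[OF Sigma_zero_mem[of u u] st(2)] unfolding u eq .
    then have "AB k j \<in> S" using True \<open>j = n + k - m\<close> by (simp add: max_def split: if_splits)
    then show ?thesis using second_less_p_in_I assms(2) u by simp
  next
    case False
    then have lm: "l + (m - k) = p" "n = j" using klmn by auto
    then have "l < p" using False by linarith
    \<comment> \<open>This gives \<open>m = k + (p - l) \<ge> p\<close>, so
      \<open>t = AB m j\<close> already serves.\<close>
    then have "l \<le> k" using st(1) eq second_less_p_le_first by simp
    then have "p \<le> m" using lm False by linarith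
    then show ?thesis using st(2) eq lm second_less_p_in_I assms(2) by simp
  qed
qed

lemma left_I_order_S:
  assumes "d = 1" "I = {0..<p}"
  shows "left_I_order S"
proof -
  have mem: "AB p y \<in> S" for y
  proof (cases "y < p")
    case True
    then show ?thesis using assms by (simp add: S_eq AB_in_hat_Lambda_iff)
  next
    case False
    \<comment> \<open>With \<open>d = 1\<close>, \<open>Sigma_set\<close> holds every
      \<open>AB x y\<close> with both exponents at least \<open>p\<close>.\<close>
    then show ?thesis using Sigma_zero_mem[of 0 "y - p"] assms by simp
  qed
  have "\<exists>s\<in>S. \<exists>t\<in>S. x = sinv s * t" for x
  proof (cases x)
    case (AB i j)
    then have "x = sinv (AB p i) * AB p j" by (simp add: sinv_AB)
    then show ?thesis using mem by blast
  qed
  then show ?thesis using subsemigroup_S by (simp add: left_I_order_def)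
qed

end

theorem proposition5p7:
  fixes S FD F :: "bicyclic set" and q p d :: nat and I P :: "nat set"
  assumes "two_sided_second_form S q p d I P FD F"
    and "S \<noteq> UNIV"
  shows "left_I_order S \<longleftrightarrow> d = 1 \<and> I = {0..<p}"
proof -
  interpret second_form S FD F q p d I P by unfold_locales (fact assms(1))
  show ?thesis
    using left_I_order_imp_d left_I_order_imp_mem_I left_I_order_S I_less by fastforce
qed

end
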